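(* Let $s\ge2$, $k\ge1$, $0\le t\le k$, $\lambda\ge1$ be integers. Consider the linear system in variables $(N_{\mathbf x})_{\mathbf x\in[s]^k}$ consisting of the equations \[ \sum_{\mathbf x\in[s]^k,\ x_i=a_i\ \forall i\in I}N_{\mathbf x}=\lambda\qquad\text{for all $t$-subsets } I\subseteq\{1,\dots,k\}\text{ and all }\mathbf a\in[s]^k, \] and let $G$ be the group of all permutations $\sigma$ of $[s]^k$ such that the coordinate permutation $N_{\mathbf x}\mapsto N_{\sigma(\mathbf x)}$ maps this set of equations onto itself (i.e. permutes the rows of its constraint matrix). If $t\ne0$ and $t\ne k$, then $G=G_{s,k}$, where $G_{s,k}\cong S_s\wr S_k$ is the group of permutations of $[s]^k$ generated by permutations of the $k$ coordinates and permutations of the levels $\{1,\dots,s\}$ within individual coordinates. If $t=0$ or $t=k$, then $G$ is the full symmetric group $S_{s^k}$ on $[s]^k$.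
   Context: $[s]=\{1,\dots,s\}$. The system above is the system whose nonnegative integer solutions correspond to orthogonal arrays $\mathrm{OA}(\lambda s^t,k,s,t)$, with $N_{\mathbf x}$ the number of times the level combination $\mathbf x$ appears as a run. *)

theory Defs
  imports
    "HOL-Algebra.Sym_Groups"
    "HOL-Algebra.Product_Groups"
begin

definition perm_group :: "'a set \<Rightarrow> ('a \<Rightarrow> 'a) monoid"
  where "perm_group X = \<lparr> carrier = {p. p permutes X}, mult = (\<circ>), one = id \<rparr>"

lemma sym_group_eq_perm_group: "sym_group n = perm_group {1..n}"
  by (simp add: sym_group_def perm_group_def)

lemma group_perm_group: "group (perm_group X)"
  using permutes_inv permutes_inv_o(2)
  by (auto intro!: groupI
         simp add: perm_group_def permutes_compose permutes_id comp_assoc, blast)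

text \<open>
  A point \<open>x\<close> of $[s]^k$ is a function with value \<open>undefined\<close> outside \<open>{1..k}\<close>.
\<close>

definition level_combs :: "nat \<Rightarrow> nat \<Rightarrow> (nat \<Rightarrow> nat) set"
  where "level_combs s k = {1..k} \<rightarrow>\<^sub>E {1..s}"


subsection \<open>The linear system\<close>

text \<open>
  A linear equation \<open>(\<Sum>x\<in>X. c x * N x) = b\<close> in unknowns \<open>N\<close> indexed by \<open>X\<close> is the pair
  \<open>(c, b)\<close>: the row \<open>c\<close> of the constraint matrix, set to 0 outside \<open>X\<close>, and the
  right-hand side \<open>b\<close>.
\<close>

type_synonym 'x lin_eq = "('x \<Rightarrow> int) \<times> int"

definition holds_lin_eq :: "'x set \<Rightarrow> ('x \<Rightarrow> int) \<Rightarrow> 'x lin_eq \<Rightarrow> bool"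
  where "holds_lin_eq X N e \<longleftrightarrow> (\<Sum>x\<in>X. fst e x * N x) = snd e"

text \<open>
  Substituting \<open>N (\<sigma> x)\<close> for \<open>N x\<close> in \<open>(c, b)\<close> gives \<open>(\<Sum>x\<in>X. c x * N (\<sigma> x)) = b\<close>, in which
  the coefficient of \<open>N y\<close> is \<open>c (inv \<sigma> y)\<close>.
\<close>

definition permute_lin_eq :: "('x \<Rightarrow> 'x) \<Rightarrow> 'x lin_eq \<Rightarrow> 'x lin_eq"
  where "permute_lin_eq \<sigma> e = (fst e \<circ> inv' \<sigma>, snd e)"

lemma holds_permute_lin_eq:
  assumes "\<sigma> permutes X"
  shows "holds_lin_eq X N (permute_lin_eq \<sigma> e) \<longleftrightarrow> holds_lin_eq X (N \<circ> \<sigma>) e"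
proof -
  have "(\<Sum>y\<in>X. fst e (inv' \<sigma> y) * N y) = (\<Sum>x\<in>X. fst e x * N (\<sigma> x))"
    using sum.permute[OF assms, of "\<lambda>y. fst e (inv' \<sigma> y) * N y"] permutes_inverses(2)[OF assms]
    by (simp add: o_def)
  then show ?thesis
    by (simp add: holds_lin_eq_def permute_lin_eq_def)
qed

definition oa_eq :: "nat \<Rightarrow> nat \<Rightarrow> nat \<Rightarrow> nat set \<Rightarrow> (nat \<Rightarrow> nat) \<Rightarrow> (nat \<Rightarrow> nat) lin_eq"
  where "oa_eq s k l I a =
    (\<lambda>x. of_bool (x \<in> level_combs s k \<and> (\<forall>i\<in>I. x i = a i)), int l)"

lemma holds_oa_eq:
  "holds_lin_eq (level_combs s k) N (oa_eq s k l I a) \<longleftrightarrow>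
    (\<Sum>x\<in>{x \<in> level_combs s k. \<forall>i\<in>I. x i = a i}. N x) = int l"
proof -
  have "finite (level_combs s k)"
    by (simp add: level_combs_def finite_PiE)
  then show ?thesis
    by (auto simp: holds_lin_eq_def oa_eq_def sum.inter_filter of_bool_def
        intro!: arg_cong[where f = "\<lambda>u. u = int l"] sum.cong)
qed

definition oa_system :: "nat \<Rightarrow> nat \<Rightarrow> nat \<Rightarrow> nat \<Rightarrow> (nat \<Rightarrow> nat) lin_eq set"
  where "oa_system s k t l =
    {oa_eq s k l I a | I a. I \<subseteq> {1..k} \<and> card I = t \<and> a \<in> level_combs s k}"

definition oa_symmetries :: "nat \<Rightarrow> nat \<Rightarrow> nat \<Rightarrow> nat \<Rightarrow> ((nat \<Rightarrow> nat) \<Rightarrow> (nat \<Rightarrow> nat)) set"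
  where "oa_symmetries s k t l =
    {\<sigma>. \<sigma> permutes level_combs s k \<and>
        permute_lin_eq \<sigma> ` oa_system s k t l = oa_system s k t l}"

lemma subgroup_oa_symmetries:
  "subgroup (oa_symmetries s k t l) (perm_group (level_combs s k))"
proof -
  let ?X = "level_combs s k" and ?E = "oa_system s k t l"
  have comp: "permute_lin_eq (p \<circ> q) ` A = permute_lin_eq p ` permute_lin_eq q ` A"
    if "p permutes ?X" "q permutes ?X" for p q and A :: "(nat \<Rightarrow> nat) lin_eq set"
    by (simp add: image_image permute_lin_eq_def comp_assoc
        o_inv_distrib[OF permutes_bij[OF that(1)] permutes_bij[OF that(2)]])
  have inv: "inv' p \<in> oa_symmetries s k t l" if "p \<in> oa_symmetries s k t l" for p
  proof -
    from that have p: "p permutes ?X" and E: "permute_lin_eq p ` ?E = ?E"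
      by (auto simp: oa_symmetries_def)
    have "permute_lin_eq (inv' p) ` ?E = permute_lin_eq (inv' p) ` permute_lin_eq p ` ?E"
      by (simp add: E)
    also have "\<dots> = permute_lin_eq (inv' p \<circ> p) ` ?E"
      using comp[OF permutes_inv[OF p] p] by simp
    also have "\<dots> = ?E"
      by (simp add: permutes_inv_o[OF p] permute_lin_eq_def)
    finally show ?thesis
      using p by (simp add: oa_symmetries_def permutes_inv)
  qed
  show ?thesis
  proof (rule group.subgroupI[OF group_perm_group])
    have "id \<in> oa_symmetries s k t l"
      by (simp add: oa_symmetries_def permute_lin_eq_def)
    then show "oa_symmetries s k t l \<noteq> {}" by auto
    fix p assume p: "p \<in> oa_symmetries s k t l"
    then have "p permutes ?X" by (simp add: oa_symmetries_def)
    then have "inv\<^bsub>perm_group ?X\<^esub> p = inv' p"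
      by (intro group.inv_equality[OF group_perm_group])
         (simp_all add: perm_group_def permutes_inv permutes_inv_o)
    with inv[OF p] show "inv\<^bsub>perm_group ?X\<^esub> p \<in> oa_symmetries s k t l" by simp
  qed (auto simp: oa_symmetries_def perm_group_def permutes_compose comp)
qed


subsection \<open>Coordinate and level permutations\<close>

definition coord_perm :: "nat \<Rightarrow> nat \<Rightarrow> (nat \<Rightarrow> nat) \<Rightarrow> (nat \<Rightarrow> nat) \<Rightarrow> (nat \<Rightarrow> nat)"
  where "coord_perm s k \<pi> = restrict_id (\<lambda>x. x \<circ> \<pi>) (level_combs s k)"

definition level_perm :: "nat \<Rightarrow> nat \<Rightarrow> nat \<Rightarrow> (nat \<Rightarrow> nat) \<Rightarrow> (nat \<Rightarrow> nat) \<Rightarrow> (nat \<Rightarrow> nat)"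
  where "level_perm s k j \<tau> = restrict_id (\<lambda>x. x(j := \<tau> (x j))) (level_combs s k)"

definition coord_level_group :: "nat \<Rightarrow> nat \<Rightarrow> ((nat \<Rightarrow> nat) \<Rightarrow> (nat \<Rightarrow> nat)) set"
  where "coord_level_group s k =
    generate (perm_group (level_combs s k))
      ({coord_perm s k \<pi> | \<pi>. \<pi> permutes {1..k}} \<union>
       {level_perm s k j \<tau> | j \<tau>. j \<in> {1..k} \<and> \<tau> permutes {1..s}})"

text \<open>
  The wreath product of \<open>A\<close> with the symmetric group on \<open>{1..n}\<close>: the semidirect product
  of $A^n$ and $S_n$, where \<open>\<pi>\<close> acts on $A^n$ by \<open>g \<mapsto> g \<circ> inv \<pi>\<close>.
\<close>

definition wreath_sym :: "('a, 'm) monoid_scheme \<Rightarrow> nat \<Rightarrow> ((nat \<Rightarrow> 'a) \<times> (nat \<Rightarrow> nat)) monoid"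
  where "wreath_sym A n = (let P = product_group {1..n} (\<lambda>_. A) in
    \<lparr> carrier = carrier P \<times> carrier (sym_group n),
      mult = (\<lambda>(f, \<pi>) (g, \<rho>). (f \<otimes>\<^bsub>P\<^esub> (g \<circ> inv' \<pi>), \<pi> \<otimes>\<^bsub>sym_group n\<^esub> \<rho>)),
      one = (\<one>\<^bsub>P\<^esub>, \<one>\<^bsub>sym_group n\<^esub>) \<rparr>)"

end

theory Submission
  imports Defs
begin

text \<open>
  Let \<open>0 < t < k\<close>. The rows of the system are the indicators of the flats
  \<open>{x. \<forall>i\<in>I. x i = a i}\<close> with \<open>card I = t\<close>, and exactly \<open>(k - d) choose t\<close> of them contain two
  given points at Hamming distance \<open>d\<close>. For \<open>d \<ge> 1\<close> this number equals \<open>(k - 1) choose t\<close> only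
  if \<open>d = 1\<close>, so a symmetry of the system is an automorphism of the Hamming graph. Such an
  automorphism does not increase, hence preserves, the Hamming distance; it is determined by its
  values on a point and the neighbours of that point, and these values are those of an element of
  the wreath product.
\<close>

section \<open>The action of the wreath product\<close>

lemma finite_level_combs: "finite (level_combs s k)"
  by (simp add: level_combs_def finite_PiE)

lemma level_combs_eqI:
  assumes "x \<in> level_combs s k" "y \<in> level_combs s k" "\<And>i. i \<in> {1..k} \<Longrightarrow> x i = y i"
  shows "x = y"
  using assms unfolding level_combs_def by (rule PiE_ext)

lemma level_combs_upd:
  assumes "x \<in> level_combs s k" "i \<in> {1..k}" "a \<in> {1..s}"
  shows "x(i := a) \<in> level_combs s k"
  using assms unfolding level_combs_def by (auto simp: PiE_iff extensional_def)

lemma level_combs_level: "x \<in> level_combs s k \<Longrightarrow> i \<in> {1..k} \<Longrightarrow> x i \<in> {1..s}"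
  unfolding level_combs_def by (rule PiE_mem)

text \<open>The level permutations are indexed by the target coordinate, and coordinate
  \<open>i\<close> is read from \<open>inv' \<pi> i\<close>; with this convention composition
  becomes exactly the multiplication of \<open>wreath_sym\<close>. Off the level combinations the
  map is the identity, as \<open>permutes\<close> demands.\<close>

definition wreath_act ::
    "nat \<Rightarrow> nat \<Rightarrow> (nat \<Rightarrow> nat \<Rightarrow> nat) \<Rightarrow> (nat \<Rightarrow> nat) \<Rightarrow> (nat \<Rightarrow> nat) \<Rightarrow> (nat \<Rightarrow> nat)"
  where "wreath_act s k f \<pi> =
    restrict_id (\<lambda>x. \<lambda>i\<in>{1..k}. f i (x (inv' \<pi> i))) (level_combs s k)"

lemma wreath_act_apply:
  assumes "x \<in> level_combs s k" "i \<in> {1..k}"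
  shows "wreath_act s k f \<pi> x i = f i (x (inv' \<pi> i))"
  using assms by (simp add: wreath_act_def)

lemma wreath_act_outside:
  assumes "x \<in> level_combs s k" "i \<notin> {1..k}"
  shows "wreath_act s k f \<pi> x i = undefined"
  using assms by (auto simp: wreath_act_def)

lemma wreath_act_cong:
  assumes "\<And>i. i \<in> {1..k} \<Longrightarrow> f i = g i"
  shows "wreath_act s k f \<pi> = wreath_act s k g \<pi>"
  using assms unfolding wreath_act_def by (intro restrict_id_cong refl restrict_ext) simp

text \<open>An element of the wreath product up to the values of \<open>f\<close> outside
  \<open>{1..k}\<close>, which are left free; the carrier of \<open>wreath_sym\<close> additionally
  fixes them by extensionality.\<close>

locale wreath_elem =
  fixes s k :: nat and f :: "nat \<Rightarrow> nat \<Rightarrow> nat" and \<pi> :: "nat \<Rightarrow> nat"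
  assumes levels: "\<And>i. i \<in> {1..k} \<Longrightarrow> f i permutes {1..s}" and coords: "\<pi> permutes {1..k}"
begin

lemma inv_coord: "i \<in> {1..k} \<Longrightarrow> inv' \<pi> i \<in> {1..k}"
  using permutes_in_image[OF permutes_inv[OF coords]] by blast

lemma wreath_act_closed:
  assumes "x \<in> level_combs s k"
  shows "wreath_act s k f \<pi> x \<in> level_combs s k"
proof -
  have "f i (x (inv' \<pi> i)) \<in> {1..s}" if "i \<in> {1..k}" for i
    using level_combs_level[OF assms inv_coord[OF that]] permutes_in_image[OF levels[OF that]] by blast
  with assms show ?thesis
    by (auto simp: wreath_act_def level_combs_def)
qed

text \<open>The semidirect product rule: the composite reads coordinate \<open>i\<close> from
  \<open>inv' \<pi> (inv' \<rho> i)\<close>, meeting \<open>f (inv' \<rho> i)\<close> first and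
  \<open>g i\<close> second.\<close>

lemma wreath_act_comp:
  "wreath_act s k g \<rho> \<circ> wreath_act s k f \<pi> =
    wreath_act s k (\<lambda>i. g i \<circ> f (inv' \<rho> i)) (\<rho> \<circ> \<pi>)" (is "?l = ?r")
  if \<rho>: "\<rho> permutes {1..k}"
proof
  fix x
  have inv: "inv' (\<rho> \<circ> \<pi>) = inv' \<pi> \<circ> inv' \<rho>"
    by (rule o_inv_distrib[OF permutes_bij[OF \<rho>] permutes_bij[OF coords]])
  show "?l x = ?r x"
  proof (cases "x \<in> level_combs s k")
    case True
    have "wreath_act s k g \<rho> (wreath_act s k f \<pi> x) i = ?r x i" for i
    proof (cases "i \<in> {1..k}")
      case i: True
      then have "inv' \<rho> i \<in> {1..k}"
        using permutes_in_image[OF permutes_inv[OF \<rho>]] by blast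
      with i True show ?thesis
        by (simp add: wreath_act_apply wreath_act_closed inv)
    next
      case False
      with True wreath_act_closed[OF True] show ?thesis
        by (simp add: wreath_act_outside del: atLeastAtMost_iff)
    qed
    then show ?thesis by auto
  next
    case False
    then show ?thesis by (simp add: wreath_act_def)
  qed
qed

lemma wreath_act_level_comp:
  "wreath_act s k g id \<circ> wreath_act s k f \<pi> = wreath_act s k (\<lambda>i. g i \<circ> f i) \<pi>"
  using wreath_act_comp[OF permutes_id] by simp

end

lemma wreath_act_id: "wreath_act s k (\<lambda>_. id) id = id"
proof
  fix x
  show "wreath_act s k (\<lambda>_. id) id x = id x"
  proof (cases "x \<in> level_combs s k")
    case True
    then have "(\<lambda>i\<in>{1..k}. x i) = x"
      unfolding level_combs_def by (auto simp: PiE_iff extensional_def)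
    with True show ?thesis by (simp add: wreath_act_def)
  qed (simp add: wreath_act_def)
qed

context wreath_elem
begin

text \<open>In the composition rule the factor at \<open>i\<close> becomes
  \<open>inv' (f (\<pi> i))\<close> after \<open>f (\<pi> i)\<close>, because
  \<open>inv' (inv' \<pi>)\<close> is \<open>\<pi>\<close>.\<close>

lemma wreath_act_left_inverse:
  "wreath_act s k (\<lambda>i. inv' (f (\<pi> i))) (inv' \<pi>) \<circ> wreath_act s k f \<pi> = id"
proof -
  have "wreath_act s k (\<lambda>i. inv' (f (\<pi> i))) (inv' \<pi>) \<circ> wreath_act s k f \<pi> =
      wreath_act s k (\<lambda>i. inv' (f (\<pi> i)) \<circ> f (inv' (inv' \<pi>) i)) (inv' \<pi> \<circ> \<pi>)"
    by (rule wreath_act_comp[OF permutes_inv[OF coords]])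
  also have "\<dots> = wreath_act s k (\<lambda>_. id) id"
    unfolding permutes_inv_o(2)[OF coords] permutes_inv_inv[OF coords]
    using permutes_inv_o(2)[OF levels] permutes_in_image[OF coords]
    by (intro wreath_act_cong) blast
  finally show ?thesis
    by (simp add: wreath_act_id)
qed

lemma wreath_act_permutes: "wreath_act s k f \<pi> permutes level_combs s k"
proof (rule bij_imp_permutes)
  \<comment> \<open>The left inverse gives injectivity; finiteness then yields surjectivity.\<close>
  have inj: "inj_on (wreath_act s k f \<pi>) (level_combs s k)"
    using wreath_act_left_inverse by (metis inj_on_id inj_on_imageI2)
  then show "bij_betw (wreath_act s k f \<pi>) (level_combs s k) (level_combs s k)"
    using endo_inj_surj[OF finite_level_combs _ inj] wreath_act_closed
    by (auto simp: bij_betw_def)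
qed (simp add: wreath_act_def)

lemma inverse_wreath_elem: "wreath_elem s k (\<lambda>i. inv' (f (\<pi> i))) (inv' \<pi>)"
  using permutes_inv[OF levels] permutes_inv[OF coords] permutes_in_image[OF coords]
  by unfold_locales blast+

end

section \<open>Generation by coordinate and level permutations\<close>

text \<open>The inverse appears because \<open>x \<circ> \<pi>\<close> reads coordinate
  \<open>\<pi> i\<close>, whereas \<open>wreath_act\<close> reads from the inverse of its coordinate
  permutation.\<close>

lemma coord_perm_eq_wreath_act:
  assumes "\<pi> permutes {1..k}"
  shows "coord_perm s k \<pi> = wreath_act s k (\<lambda>_. id) (inv' \<pi>)"
proof
  fix x
  show "coord_perm s k \<pi> x = wreath_act s k (\<lambda>_. id) (inv' \<pi>) x"
  proof (cases "x \<in> level_combs s k")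
    case True
    then have "x (\<pi> i) = undefined" if "i \<notin> {1..k}" for i
      using that permutes_not_in[OF assms that]
      by (auto simp: level_combs_def PiE_iff extensional_def)
    with True show ?thesis
      by (auto simp: coord_perm_def wreath_act_def permutes_inv_inv[OF assms])
  qed (simp add: coord_perm_def wreath_act_def)
qed

lemma level_perm_eq_wreath_act:
  assumes "j \<in> {1..k}"
  shows "level_perm s k j \<tau> = wreath_act s k ((\<lambda>_. id)(j := \<tau>)) id"
proof
  fix x
  show "level_perm s k j \<tau> x = wreath_act s k ((\<lambda>_. id)(j := \<tau>)) id x"
    using assms
    by (cases "x \<in> level_combs s k")
      (auto simp: level_perm_def wreath_act_def level_combs_def PiE_iff extensional_def)
qed

definition wreath_perms :: "nat \<Rightarrow> nat \<Rightarrow> ((nat \<Rightarrow> nat) \<Rightarrow> (nat \<Rightarrow> nat)) set"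
  where "wreath_perms s k = {wreath_act s k f \<pi> | f \<pi>. wreath_elem s k f \<pi>}"

lemma wreath_elem_comp:
  assumes "wreath_elem s k f \<pi>" "wreath_elem s k g \<rho>"
  shows "wreath_elem s k (\<lambda>i. f i \<circ> g (inv' \<pi> i)) (\<pi> \<circ> \<rho>)"
proof -
  interpret P: wreath_elem s k f \<pi> by fact
  interpret Q: wreath_elem s k g \<rho> by fact
  show ?thesis
    by unfold_locales (intro permutes_compose P.levels Q.levels P.coords Q.coords P.inv_coord; simp)+
qed

lemma subgroup_wreath_perms: "subgroup (wreath_perms s k) (perm_group (level_combs s k))"
proof (rule group.subgroupI[OF group_perm_group])
  show "wreath_perms s k \<subseteq> carrier (perm_group (level_combs s k))"
    using wreath_elem.wreath_act_permutes by (auto simp: wreath_perms_def perm_group_def)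
  have "wreath_elem s k (\<lambda>_. id) id"
    by unfold_locales (simp_all add: permutes_id)
  then show "wreath_perms s k \<noteq> {}"
    unfolding wreath_perms_def by blast
next
  fix p assume "p \<in> wreath_perms s k"
  then obtain f \<pi> where p: "p = wreath_act s k f \<pi>" and w: "wreath_elem s k f \<pi>"
    by (auto simp: wreath_perms_def)
  interpret wreath_elem s k f \<pi> by fact
  interpret inverse: wreath_elem s k "\<lambda>i. inv' (f (\<pi> i))" "inv' \<pi>"
    by (rule inverse_wreath_elem)
  have "inv\<^bsub>perm_group (level_combs s k)\<^esub> p = wreath_act s k (\<lambda>i. inv' (f (\<pi> i))) (inv' \<pi>)"
    using wreath_act_left_inverse wreath_act_permutes inverse.wreath_act_permutes
    by (intro group.inv_equality[OF group_perm_group]) (simp_all add: p perm_group_def)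
  then show "inv\<^bsub>perm_group (level_combs s k)\<^esub> p \<in> wreath_perms s k"
    using inverse_wreath_elem unfolding wreath_perms_def by blast
next
  fix p q assume "p \<in> wreath_perms s k" "q \<in> wreath_perms s k"
  then obtain f \<pi> g \<rho> where p: "p = wreath_act s k f \<pi>" "wreath_elem s k f \<pi>"
    and q: "q = wreath_act s k g \<rho>" "wreath_elem s k g \<rho>"
    by (auto simp: wreath_perms_def)
  have "p \<circ> q = wreath_act s k (\<lambda>i. f i \<circ> g (inv' \<pi> i)) (\<pi> \<circ> \<rho>)"
    unfolding p q by (rule wreath_elem.wreath_act_comp[OF q(2) wreath_elem.coords[OF p(2)]])
  then show "p \<otimes>\<^bsub>perm_group (level_combs s k)\<^esub> q \<in> wreath_perms s k"
    using wreath_elem_comp[OF p(2) q(2)] by (auto simp: wreath_perms_def perm_group_def)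
qed

text \<open>The generators lie in the subgroup \<open>wreath_perms s k\<close>. Conversely, an
  element of that subgroup is a coordinate permutation followed by level permutations, one
  coordinate at a time.\<close>

lemma coord_level_group_eq: "coord_level_group s k = wreath_perms s k"
proof (rule antisym)
  have "wreath_act s k (\<lambda>_. id) (inv' \<pi>) \<in> wreath_perms s k" if "\<pi> permutes {1..k}" for \<pi>
  proof -
    have "wreath_elem s k (\<lambda>_. id) (inv' \<pi>)"
      using permutes_inv[OF that] by unfold_locales (simp_all add: permutes_id)
    then show ?thesis unfolding wreath_perms_def by blast
  qed
  moreover have "wreath_act s k ((\<lambda>_. id)(j := \<tau>)) id \<in> wreath_perms s k"
    if "\<tau> permutes {1..s}" for j \<tau>
  proof -
    have "wreath_elem s k ((\<lambda>_. id)(j := \<tau>)) id"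
      using that by unfold_locales (auto simp: permutes_id)
    then show ?thesis unfolding wreath_perms_def by blast
  qed
  ultimately show "coord_level_group s k \<subseteq> wreath_perms s k"
    unfolding coord_level_group_def
    by (intro group.generate_subgroup_incl[OF group_perm_group _ subgroup_wreath_perms])
      (auto simp: coord_perm_eq_wreath_act level_perm_eq_wreath_act)
next
  have mult: "p \<circ> q \<in> coord_level_group s k"
    if "p \<in> coord_level_group s k" "q \<in> coord_level_group s k" for p q
    using generate.eng[OF that[unfolded coord_level_group_def]]
    by (simp add: coord_level_group_def perm_group_def)
  show "wreath_perms s k \<subseteq> coord_level_group s k"
  proof
    fix p assume "p \<in> wreath_perms s k"
    then obtain f \<pi> where p: "p = wreath_act s k f \<pi>" and w: "wreath_elem s k f \<pi>"
      by (auto simp: wreath_perms_def)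
    interpret wreath_elem s k f \<pi> by fact
    \<comment> \<open>Induction on the set \<open>J\<close> of coordinates whose level permutation
      has already been applied.\<close>
    have lev: "wreath_act s k (\<lambda>i. if i \<in> J then f i else id) id \<in> coord_level_group s k"
      if "finite J" "J \<subseteq> {1..k}" for J
      using that
    proof (induction J)
      case empty
      have "id \<in> coord_level_group s k"
        unfolding coord_level_group_def
        using generate.one[of "perm_group (level_combs s k)"] by (simp add: perm_group_def)
      then show ?case by (simp only: empty_iff if_False wreath_act_id)
    next
      case (insert j J)
      interpret J: wreath_elem s k "\<lambda>i. if i \<in> J then f i else id" id
        using insert levels by unfold_locales (auto simp: permutes_id)
      have "level_perm s k j (f j) \<in> coord_level_group s k"
        unfolding coord_level_group_def using insert levels by (intro generate.incl) blast
      moreover have "wreath_act s k (\<lambda>i. if i \<in> J then f i else id) id \<in> coord_level_group s k"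
        using insert by blast
      ultimately have "level_perm s k j (f j) \<circ> wreath_act s k (\<lambda>i. if i \<in> J then f i else id) id
          \<in> coord_level_group s k"
        by (rule mult)
      also have "level_perm s k j (f j) \<circ> wreath_act s k (\<lambda>i. if i \<in> J then f i else id) id =
          wreath_act s k (\<lambda>i. ((\<lambda>_. id)(j := f j)) i \<circ> (if i \<in> J then f i else id)) id"
        using insert J.wreath_act_level_comp by (simp add: level_perm_eq_wreath_act)
      also have "\<dots> = wreath_act s k (\<lambda>i. if i \<in> insert j J then f i else id) id"
        using insert by (intro wreath_act_cong) auto
      finally show ?case .
    qed
    interpret \<pi>: wreath_elem s k "\<lambda>_. id" \<pi>
      using coords by unfold_locales (simp_all add: permutes_id)
    have "coord_perm s k (inv' \<pi>) \<in> coord_level_group s k"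
      unfolding coord_level_group_def using permutes_inv[OF coords] by (intro generate.incl) blast
    with lev[of "{1..k}"] have "wreath_act s k (\<lambda>i. if i \<in> {1..k} then f i else id) id \<circ>
        coord_perm s k (inv' \<pi>) \<in> coord_level_group s k"
      by (intro mult) auto
    also have "wreath_act s k (\<lambda>i. if i \<in> {1..k} then f i else id) id \<circ> coord_perm s k (inv' \<pi>) =
        wreath_act s k (\<lambda>i. (if i \<in> {1..k} then f i else id) \<circ> id) \<pi>"
      using \<pi>.wreath_act_level_comp
      unfolding coord_perm_eq_wreath_act[OF permutes_inv[OF coords]] permutes_inv_inv[OF coords]
      by simp
    also have "\<dots> = p"
      unfolding p by (intro wreath_act_cong) simp
    finally show "p \<in> coord_level_group s k" .
  qed
qed

section \<open>Isomorphism with the abstract wreath product\<close>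

text \<open>Constant points do not see the coordinate permutation and so recover \<open>f\<close>;
  points with one exceptional coordinate, available because there are two levels, then recover
  \<open>\<pi>\<close>.\<close>

lemma wreath_act_inject:
  assumes "s \<ge> 2" and P: "wreath_elem s k f \<pi>" and Q: "wreath_elem s k g \<rho>"
    and eq: "wreath_act s k f \<pi> = wreath_act s k g \<rho>"
  shows "\<pi> = \<rho> \<and> (\<forall>i\<in>{1..k}. f i = g i)"
proof -
  interpret P: wreath_elem s k f \<pi> by fact
  interpret Q: wreath_elem s k g \<rho> by fact
  have val: "f i (x (inv' \<pi> i)) = g i (x (inv' \<rho> i))"
    if "x \<in> level_combs s k" "i \<in> {1..k}" for x i
    using wreath_act_apply[OF that] eq by metis
  let ?c = "\<lambda>a. \<lambda>i\<in>{1..k}. a"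
  have c: "?c a \<in> level_combs s k" if "a \<in> {1..s}" for a :: nat
    using that by (simp add: level_combs_def)
  have fg: "f i = g i" if "i \<in> {1..k}" for i
  proof
    fix a show "f i a = g i a"
    proof (cases "a \<in> {1..s}")
      case True
      then show ?thesis
        using val[OF c[OF True] that] P.inv_coord[OF that] Q.inv_coord[OF that] by simp
    next
      case False
      then show ?thesis
        using permutes_not_in[OF P.levels[OF that]] permutes_not_in[OF Q.levels[OF that]] by simp
    qed
  qed
  have "inv' \<pi> i = inv' \<rho> i" for i
  proof (cases "i \<in> {1..k}")
    case True
    show ?thesis
    proof (rule ccontr)
      assume neq: "inv' \<pi> i \<noteq> inv' \<rho> i"
      \<comment> \<open>At coordinate \<open>i\<close> the first map reads the level 2 of this point
        and the second reads 1, contradicting injectivity of \<open>f i = g i\<close>.\<close>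
      have "(?c 1)(inv' \<pi> i := 2) \<in> level_combs s k"
        using \<open>s \<ge> 2\<close> by (intro level_combs_upd c P.inv_coord True) auto
      from val[OF this True] neq have "f i 2 = f i 1"
        using Q.inv_coord[OF True] fg[OF True] by simp
      then show False
        using permutes_inj[OF P.levels[OF True]] by (simp add: inj_eq)
    qed
  next
    case False
    then show ?thesis
      using permutes_not_in[OF permutes_inv[OF P.coords]] permutes_not_in[OF permutes_inv[OF Q.coords]]
      by simp
  qed
  then have "inv' (inv' \<pi>) = inv' (inv' \<rho>)" by (metis ext)
  then show ?thesis
    using fg by (simp add: permutes_inv_inv[OF P.coords] permutes_inv_inv[OF Q.coords])
qed

lemma carrier_wreath_sym:
  "carrier (wreath_sym (sym_group s) k) = {(f, \<pi>). f \<in> extensional {1..k} \<and> wreath_elem s k f \<pi>}"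
proof -
  have "f \<in> {1..k} \<rightarrow>\<^sub>E {p. p permutes {1..s}} \<and> \<pi> permutes {1..k} \<longleftrightarrow>
      f \<in> extensional {1..k} \<and> wreath_elem s k f \<pi>" for f \<pi>
    unfolding PiE_iff wreath_elem_def by blast
  then show ?thesis
    unfolding wreath_sym_def Let_def sym_group_def by auto
qed

lemma wreath_sym_mult_closed:
  assumes "u \<in> carrier (wreath_sym (sym_group s) k)" "v \<in> carrier (wreath_sym (sym_group s) k)"
  shows "u \<otimes>\<^bsub>wreath_sym (sym_group s) k\<^esub> v \<in> carrier (wreath_sym (sym_group s) k)"
proof -
  obtain f \<pi> g \<rho> where u: "u = (f, \<pi>)" "wreath_elem s k f \<pi>"
    and v: "v = (g, \<rho>)" "wreath_elem s k g \<rho>"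
    using assms by (auto simp: carrier_wreath_sym)
  have "wreath_elem s k (\<lambda>i\<in>{1..k}. f i \<circ> g (inv' \<pi> i)) (\<pi> \<circ> \<rho>)"
    using wreath_elem_comp[OF u(2) v(2)] by (simp add: wreath_elem_def)
  then show ?thesis
    by (simp add: u v wreath_sym_def Let_def sym_group_def wreath_elem_def o_def)
qed

text \<open>Closure of the domain under multiplication suffices to invert an isomorphism, so the
  group axioms need not be verified for \<open>wreath_sym\<close>.\<close>

lemma iso_inv_into:
  assumes iso: "h \<in> iso G H"
    and closed: "\<And>x y. \<lbrakk>x \<in> carrier G; y \<in> carrier G\<rbrakk> \<Longrightarrow> x \<otimes>\<^bsub>G\<^esub> y \<in> carrier G"
  shows "inv_into (carrier G) h \<in> iso H G"
proof -
  let ?g = "inv_into (carrier G) h"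
  from iso have h: "h \<in> hom G H" and bij: "bij_betw h (carrier G) (carrier H)"
    by (auto simp: iso_def)
  have g: "?g u \<in> carrier G" "h (?g u) = u" if "u \<in> carrier H" for u
    using that bij_betw_imp_surj_on[OF bij] by (auto simp: inv_into_into f_inv_into_f)
  have "?g (u \<otimes>\<^bsub>H\<^esub> v) = ?g u \<otimes>\<^bsub>G\<^esub> ?g v" if "u \<in> carrier H" "v \<in> carrier H" for u v
  proof -
    have "h (?g u \<otimes>\<^bsub>G\<^esub> ?g v) = u \<otimes>\<^bsub>H\<^esub> v"
      using h g that by (simp add: hom_mult)
    then show ?thesis
      using closed[OF g(1) g(1)] that bij by (metis bij_betw_def inv_into_f_f)
  qed
  with g bij_betw_inv_into[OF bij] show ?thesis
    by (simp add: iso_def hom_def)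
qed

lemma wreath_act_iso:
  assumes "s \<ge> 2"
  shows "case_prod (wreath_act s k) \<in>
    iso (wreath_sym (sym_group s) k) ((perm_group (level_combs s k)) \<lparr> carrier := wreath_perms s k \<rparr>)"
  unfolding iso_def mem_Collect_eq
proof
  show "case_prod (wreath_act s k) \<in>
    hom (wreath_sym (sym_group s) k) ((perm_group (level_combs s k)) \<lparr> carrier := wreath_perms s k \<rparr>)"
  proof (rule homI)
    fix u v
    assume "u \<in> carrier (wreath_sym (sym_group s) k)" "v \<in> carrier (wreath_sym (sym_group s) k)"
    then obtain f \<pi> g \<rho> where u: "u = (f, \<pi>)" "wreath_elem s k f \<pi>"
      and v: "v = (g, \<rho>)" "wreath_elem s k g \<rho>"
      by (auto simp: carrier_wreath_sym)
    have "u \<otimes>\<^bsub>wreath_sym (sym_group s) k\<^esub> v = (\<lambda>i\<in>{1..k}. f i \<circ> g (inv' \<pi> i), \<pi> \<circ> \<rho>)"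
      by (simp add: u v wreath_sym_def Let_def sym_group_def o_def)
    moreover have "wreath_act s k f \<pi> \<circ> wreath_act s k g \<rho> =
        wreath_act s k (\<lambda>i\<in>{1..k}. f i \<circ> g (inv' \<pi> i)) (\<pi> \<circ> \<rho>)"
      unfolding wreath_elem.wreath_act_comp[OF v(2) wreath_elem.coords[OF u(2)]]
      by (intro wreath_act_cong) simp
    ultimately show "case_prod (wreath_act s k) (u \<otimes>\<^bsub>wreath_sym (sym_group s) k\<^esub> v) =
      case_prod (wreath_act s k) u
        \<otimes>\<^bsub>(perm_group (level_combs s k)) \<lparr> carrier := wreath_perms s k \<rparr>\<^esub>
      case_prod (wreath_act s k) v"
      by (simp add: u v perm_group_def)
  qed (auto simp: carrier_wreath_sym wreath_perms_def)
  have "inj_on (case_prod (wreath_act s k)) (carrier (wreath_sym (sym_group s) k))"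
  proof (rule inj_onI)
    fix u v
    assume "u \<in> carrier (wreath_sym (sym_group s) k)" "v \<in> carrier (wreath_sym (sym_group s) k)"
      and eq: "case_prod (wreath_act s k) u = case_prod (wreath_act s k) v"
    then obtain f \<pi> g \<rho> where u: "u = (f, \<pi>)" "f \<in> extensional {1..k}" "wreath_elem s k f \<pi>"
      and v: "v = (g, \<rho>)" "g \<in> extensional {1..k}" "wreath_elem s k g \<rho>"
      by (auto simp: carrier_wreath_sym)
    have "\<pi> = \<rho> \<and> (\<forall>i\<in>{1..k}. f i = g i)"
      using eq by (intro wreath_act_inject[OF assms u(3) v(3)]) (simp add: u v)
    moreover from this have "f = g"
      using u(2) v(2) by (intro extensionalityI[of f "{1..k}" g]) auto
    ultimately show "u = v" by (simp add: u v)
  qed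
  moreover have "wreath_perms s k \<subseteq>
      case_prod (wreath_act s k) ` carrier (wreath_sym (sym_group s) k)"
  proof
    fix p assume "p \<in> wreath_perms s k"
    then obtain f \<pi> where p: "p = wreath_act s k f \<pi>" and w: "wreath_elem s k f \<pi>"
      by (auto simp: wreath_perms_def)
    have "p = wreath_act s k (restrict f {1..k}) \<pi>"
      unfolding p by (intro wreath_act_cong) simp
    moreover have "(restrict f {1..k}, \<pi>) \<in> carrier (wreath_sym (sym_group s) k)"
      using w by (simp add: carrier_wreath_sym wreath_elem_def)
    ultimately show "p \<in> case_prod (wreath_act s k) ` carrier (wreath_sym (sym_group s) k)"
      by (metis case_prod_conv image_eqI)
  qed
  ultimately show "bij_betw (case_prod (wreath_act s k)) (carrier (wreath_sym (sym_group s) k))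
      (carrier ((perm_group (level_combs s k)) \<lparr> carrier := wreath_perms s k \<rparr>))"
    by (auto simp: bij_betw_def carrier_wreath_sym wreath_perms_def)
qed


section \<open>Automorphisms of the Hamming graph\<close>

definition diff_coords :: "nat \<Rightarrow> (nat \<Rightarrow> nat) \<Rightarrow> (nat \<Rightarrow> nat) \<Rightarrow> nat set"
  where "diff_coords k x y = {i \<in> {1..k}. x i \<noteq> y i}"

definition hamming :: "nat \<Rightarrow> (nat \<Rightarrow> nat) \<Rightarrow> (nat \<Rightarrow> nat) \<Rightarrow> nat"
  where "hamming k x y = card (diff_coords k x y)"

lemma finite_diff_coords [simp]: "finite (diff_coords k x y)"
  by (simp add: diff_coords_def)

lemma hamming_commute: "hamming k x y = hamming k y x"
  unfolding hamming_def diff_coords_def by (rule arg_cong[where f = card]) auto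

lemma hamming_triangle: "hamming k x z \<le> hamming k x y + hamming k y z"
proof -
  have "diff_coords k x z \<subseteq> diff_coords k x y \<union> diff_coords k y z"
    by (auto simp: diff_coords_def)
  then have "card (diff_coords k x z) \<le> card (diff_coords k x y \<union> diff_coords k y z)"
    by (intro card_mono) auto
  also have "\<dots> \<le> card (diff_coords k x y) + card (diff_coords k y z)"
    by (rule card_Un_le)
  finally show ?thesis by (simp add: hamming_def)
qed

lemma hamming_eq_0:
  assumes "x \<in> level_combs s k" "y \<in> level_combs s k"
  shows "hamming k x y = 0 \<longleftrightarrow> x = y"
  using level_combs_eqI[OF assms] by (auto simp: hamming_def diff_coords_def)

lemma hamming_upd:
  assumes "i \<in> {1..k}" "a \<noteq> x i"
  shows "hamming k (x(i := a)) x = 1"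
proof -
  have "diff_coords k (x(i := a)) x = {i}"
    using assms by (auto simp: diff_coords_def)
  then show ?thesis by (simp add: hamming_def)
qed

lemma hamming_1E:
  assumes "x \<in> level_combs s k" "y \<in> level_combs s k" "hamming k x y = 1"
  obtains i where "i \<in> {1..k}" "x i \<noteq> y i" "x = y(i := x i)"
proof -
  from assms(3) obtain i where D: "diff_coords k x y = {i}"
    by (auto simp: hamming_def card_1_singleton_iff)
  then have "i \<in> diff_coords k x y" by simp
  then have i: "i \<in> {1..k}" "x i \<noteq> y i" by (auto simp: diff_coords_def)
  have "x j = (y(i := x i)) j" if "j \<in> {1..k}" for j
  proof (cases "j = i")
    case False
    with D have "j \<notin> diff_coords k x y" by simp
    with that False show ?thesis by (simp add: diff_coords_def)
  qed simp
  then have "x = y(i := x i)"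
    by (intro level_combs_eqI[OF assms(1)] level_combs_upd[OF assms(2) i(1)]
        level_combs_level[OF assms(1) i(1)])
  with i show ?thesis by (rule that)
qed

text \<open>Changing the coordinates of \<open>x\<close> into those of \<open>y\<close> one by one
  gives a path of \<open>hamming k x y\<close> edges; its image is again a path, and the triangle
  inequality bounds the distance of its ends.\<close>

lemma hamming_1_nonincreasing:
  assumes closed: "\<And>x. x \<in> level_combs s k \<Longrightarrow> \<sigma> x \<in> level_combs s k"
    and edge: "\<And>x y. \<lbrakk>x \<in> level_combs s k; y \<in> level_combs s k; hamming k x y = 1\<rbrakk> \<Longrightarrow>
      hamming k (\<sigma> x) (\<sigma> y) = 1"
    and "x \<in> level_combs s k" "y \<in> level_combs s k"
  shows "hamming k (\<sigma> x) (\<sigma> y) \<le> hamming k x y"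
  using assms(3,4)
proof (induction "hamming k x y" arbitrary: x)
  case 0
  then have "x = y" by (metis hamming_eq_0)
  then show ?case by (simp add: hamming_def diff_coords_def)
next
  case (Suc n)
  then obtain i where i: "i \<in> diff_coords k x y"
    unfolding hamming_def by (metis card.empty equals0I nat.distinct(1))
  let ?z = "x(i := y i)"
  from i have "i \<in> {1..k}" by (simp add: diff_coords_def)
  then have z: "?z \<in> level_combs s k"
    using Suc.prems by (intro level_combs_upd level_combs_level[of y s k])
  have "diff_coords k ?z y = diff_coords k x y - {i}"
    by (auto simp: diff_coords_def)
  with i Suc.hyps(2) have zy: "n = hamming k ?z y"
    by (simp add: hamming_def)
  from i have "hamming k ?z x = 1"
    by (intro hamming_upd) (auto simp: diff_coords_def)
  then have "hamming k (\<sigma> x) (\<sigma> ?z) = 1"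
    using edge[OF z Suc.prems(1)] hamming_commute by metis
  moreover have "hamming k (\<sigma> ?z) (\<sigma> y) \<le> n"
    using Suc.hyps(1)[OF zy z Suc.prems(2)] zy by simp
  ultimately show ?case
    using hamming_triangle[of k "\<sigma> x" "\<sigma> y" "\<sigma> ?z"] Suc.hyps(2) by linarith
qed

text \<open>Both \<open>\<sigma>\<close> and its inverse map edges to edges, so neither increases
  distances.\<close>

lemma hamming_automorphism_isometry:
  assumes \<sigma>: "\<sigma> permutes level_combs s k"
    and edge: "\<And>x y. \<lbrakk>x \<in> level_combs s k; y \<in> level_combs s k\<rbrakk> \<Longrightarrow>
      hamming k (\<sigma> x) (\<sigma> y) = 1 \<longleftrightarrow> hamming k x y = 1"
    and x: "x \<in> level_combs s k" and y: "y \<in> level_combs s k"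
  shows "hamming k (\<sigma> x) (\<sigma> y) = hamming k x y"
proof (rule antisym)
  note closed = permutes_in_image[OF \<sigma>] permutes_in_image[OF permutes_inv[OF \<sigma>]]
  show "hamming k (\<sigma> x) (\<sigma> y) \<le> hamming k x y"
    using x y edge closed by (intro hamming_1_nonincreasing) auto
  have "hamming k (inv' \<sigma> (\<sigma> x)) (inv' \<sigma> (\<sigma> y)) \<le> hamming k (\<sigma> x) (\<sigma> y)"
  proof (rule hamming_1_nonincreasing[of s k "inv' \<sigma>"])
    fix u v assume uv: "u \<in> level_combs s k" "v \<in> level_combs s k" "hamming k u v = 1"
    then show "hamming k (inv' \<sigma> u) (inv' \<sigma> v) = 1"
      using edge[of "inv' \<sigma> u" "inv' \<sigma> v"] closed permutes_inverses(1)[OF \<sigma>] by simp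
  qed (use x y closed in auto)
  then show "hamming k x y \<le> hamming k (\<sigma> x) (\<sigma> y)"
    by (simp add: permutes_inverses(2)[OF \<sigma>])
qed

section \<open>Reconstruction of a wreath element from an automorphism\<close>

lemma restrict_id_permutes:
  assumes "finite A" "f ` A \<subseteq> A" "inj_on f A"
  shows "restrict_id f A permutes A"
  using endo_inj_surj[OF assms] assms(3) by (intro permutes_restrict_id) (simp add: bij_betw_def)

lemma hamming_automorphism_wreath:
  assumes s: "s \<ge> 2" and \<sigma>: "\<sigma> permutes level_combs s k"
    and edge: "\<And>x y. \<lbrakk>x \<in> level_combs s k; y \<in> level_combs s k\<rbrakk> \<Longrightarrow>
      hamming k (\<sigma> x) (\<sigma> y) = 1 \<longleftrightarrow> hamming k x y = 1"
  shows "\<sigma> \<in> wreath_perms s k"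
proof -
  let ?X = "level_combs s k"
  have iso: "hamming k (\<sigma> x) (\<sigma> y) = hamming k x y" if "x \<in> ?X" "y \<in> ?X" for x y
    using that edge by (rule hamming_automorphism_isometry[OF \<sigma>, rotated])
  have closed: "\<sigma> x \<in> ?X" if "x \<in> ?X" for x
    using that permutes_in_image[OF \<sigma>] by blast
  have \<sigma>_inj: "\<sigma> x = \<sigma> y \<Longrightarrow> x = y" for x y
    using permutes_inj[OF \<sigma>] by (simp add: inj_eq)
  \<comment> \<open>Base point with all levels 1; \<open>nb i a\<close> replaces its level at
    \<open>i\<close> by \<open>a\<close>, and is a neighbour of it unless
    \<open>a = 1\<close>.\<close>
  define o1 where "o1 = (\<lambda>i\<in>{1..k}. 1::nat)"
  define nb where "nb i a = o1(i := a)" for i a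
  have o1: "o1 \<in> ?X" using s by (simp add: o1_def level_combs_def)
  have o1_i: "o1 i = 1" if "i \<in> {1..k}" for i using that by (simp add: o1_def)
  have nb: "nb i a \<in> ?X" if "i \<in> {1..k}" "a \<in> {1..s}" for i a
    unfolding nb_def by (intro level_combs_upd o1 that)
  have nb_1: "nb i 1 = o1" if "i \<in> {1..k}" for i
    using o1_i[OF that] by (auto simp: nb_def)
  have two: "2 \<in> {1..s}" using s by simp

  \<comment> \<open>The image of the edge from \<open>o1\<close> to \<open>nb i 2\<close> is an
    edge, hence runs along a single coordinate; this coordinate is chosen as
    \<open>\<pi> i\<close>.\<close>
  have "\<exists>j\<in>{1..k}. \<sigma> (nb i 2) j \<noteq> \<sigma> o1 j \<and> \<sigma> (nb i 2) = (\<sigma> o1)(j := \<sigma> (nb i 2) j)"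
    if "i \<in> {1..k}" for i
  proof -
    have "hamming k (nb i 2) o1 = 1"
      unfolding nb_def using that o1_i[OF that] by (intro hamming_upd) auto
    then have "hamming k (\<sigma> (nb i 2)) (\<sigma> o1) = 1"
      using iso[OF nb[OF that two] o1] by simp
    then show ?thesis
      using hamming_1E[OF closed[OF nb[OF that two]] closed[OF o1]] by metis
  qed
  then obtain \<pi> where \<pi>: "\<And>i. i \<in> {1..k} \<Longrightarrow> \<pi> i \<in> {1..k} \<and> \<sigma> (nb i 2) (\<pi> i) \<noteq> \<sigma> o1 (\<pi> i) \<and>
      \<sigma> (nb i 2) = (\<sigma> o1)(\<pi> i := \<sigma> (nb i 2) (\<pi> i))"
    by metis
  then have \<pi>_closed: "\<pi> i \<in> {1..k}" if "i \<in> {1..k}" for i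
    using that by blast
  define f where "f i a = \<sigma> (nb i a) (\<pi> i)" for i a

  text \<open>
    The points \<open>nb i a\<close> with \<open>a \<noteq> 1\<close> are pairwise adjacent neighbours of \<open>o1\<close>, so their images
    differ from that of \<open>o1\<close> in a common coordinate.
  \<close>
  have \<sigma>_nb: "\<sigma> (nb i a) = (\<sigma> o1)(\<pi> i := f i a)" if i: "i \<in> {1..k}" and a: "a \<in> {1..s}" for i a
  proof (cases "a = 1 \<or> a = 2")
    case True
    then show ?thesis
      using \<pi>[OF i] nb_1[OF i] by (auto simp: f_def)
  next
    case False
    have "hamming k (nb i a) o1 = 1"
      unfolding nb_def using i False o1_i[OF i] by (intro hamming_upd) auto
    then have "hamming k (\<sigma> (nb i a)) (\<sigma> o1) = 1"
      using iso[OF nb[OF i a] o1] by simp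
    then obtain j where j: "j \<in> {1..k}" "\<sigma> (nb i a) j \<noteq> \<sigma> o1 j"
        "\<sigma> (nb i a) = (\<sigma> o1)(j := \<sigma> (nb i a) j)"
      by (rule hamming_1E[OF closed[OF nb[OF i a]] closed[OF o1]])
    have "j = \<pi> i"
    proof (rule ccontr)
      assume neq: "j \<noteq> \<pi> i"
      have "nb i a = (nb i 2)(i := a)" "nb i 2 i \<noteq> a" using False by (auto simp: nb_def)
      then have "hamming k (nb i a) (nb i 2) = 1"
        using hamming_upd[OF i, of a "nb i 2"] by simp
      then have "hamming k (\<sigma> (nb i a)) (\<sigma> (nb i 2)) = 1"
        using iso[OF nb[OF i a] nb[OF i two]] by simp
      \<comment> \<open>At each of the two coordinates exactly one of the two images departs from
        \<open>\<sigma> o1\<close>.\<close>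
      moreover have "{j, \<pi> i} \<subseteq> diff_coords k (\<sigma> (nb i a)) (\<sigma> (nb i 2))"
        using j \<pi>[OF i] neq unfolding diff_coords_def
        by (smt (verit) empty_subsetI fun_upd_apply insert_subset mem_Collect_eq)
      then have "card {j, \<pi> i} \<le> hamming k (\<sigma> (nb i a)) (\<sigma> (nb i 2))"
        unfolding hamming_def by (intro card_mono) auto
      ultimately show False using neq by simp
    qed
    with j(3) show ?thesis by (simp add: f_def)
  qed
  have f_closed: "f i a \<in> {1..s}" if "i \<in> {1..k}" "a \<in> {1..s}" for i a
    unfolding f_def by (rule level_combs_level[OF closed[OF nb[OF that]] \<pi>_closed[OF that(1)]])
  have f_inj: "a = b" if "i \<in> {1..k}" "a \<in> {1..s}" "b \<in> {1..s}" "f i a = f i b" for i a b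
  proof -
    have "nb i a = nb i b"
      using that \<sigma>_nb by (auto intro!: \<sigma>_inj[of "nb i a" "nb i b"])
    then show ?thesis unfolding nb_def by (metis fun_upd_same)
  qed
  have f_1: "f i 1 = \<sigma> o1 (\<pi> i)" if "i \<in> {1..k}" for i
    unfolding f_def nb_1[OF that] ..
  \<comment> \<open>Neighbours of \<open>o1\<close> in different directions are at distance 2, but
    if the directions had the same image, their images would differ in at most one
    coordinate.\<close>
  have \<pi>_inj: "i = j" if i: "i \<in> {1..k}" and j: "j \<in> {1..k}" and eq: "\<pi> i = \<pi> j" for i j
  proof (rule ccontr)
    assume "i \<noteq> j"
    then have "diff_coords k (nb i 2) (nb j 2) = {i, j}"
      using i j o1_i by (auto simp: diff_coords_def nb_def)
    with \<open>i \<noteq> j\<close> have "hamming k (\<sigma> (nb i 2)) (\<sigma> (nb j 2)) = 2"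
      using iso[OF nb[OF i two] nb[OF j two]] by (simp add: hamming_def)
    moreover have "diff_coords k (\<sigma> (nb i 2)) (\<sigma> (nb j 2)) \<subseteq> {\<pi> i}"
      unfolding \<sigma>_nb[OF i two] \<sigma>_nb[OF j two] eq by (auto simp: diff_coords_def)
    then have "hamming k (\<sigma> (nb i 2)) (\<sigma> (nb j 2)) \<le> card {\<pi> i}"
      unfolding hamming_def by (intro card_mono) auto
    ultimately show False by simp
  qed

  text \<open>
    For each of the \<open>w\<close> coordinates \<open>i\<close> with \<open>x i \<noteq> 1\<close> the image of \<open>x\<close> is at distance \<open>w - 1\<close>
    from that of \<open>nb i (x i)\<close>, hence agrees with it at \<open>\<pi> i\<close>; as the image of \<open>x\<close> is at distance
    \<open>w\<close> from that of \<open>o1\<close>, it agrees with the latter elsewhere.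
  \<close>
  have key: "\<sigma> x (\<pi> i) = f i (x i)" if x: "x \<in> ?X" and i: "i \<in> {1..k}" for x i
  proof -
    let ?S = "diff_coords k x o1" and ?T = "diff_coords k (\<sigma> x) (\<sigma> o1)"
    have card_T: "card ?T = card ?S"
      using iso[OF x o1] by (simp add: hamming_def)
    have on_S: "\<sigma> x (\<pi> j) = f j (x j)" if "j \<in> ?S" for j
    proof (rule ccontr)
      assume neq: "\<sigma> x (\<pi> j) \<noteq> f j (x j)"
      from that have j: "j \<in> {1..k}" by (simp add: diff_coords_def)
      note xj = level_combs_level[OF x j]
      have "diff_coords k x (nb j (x j)) = ?S - {j}"
        by (auto simp: diff_coords_def nb_def)
      then have "hamming k x (nb j (x j)) < card ?S"
        using that by (simp add: hamming_def card_Diff1_less del: card_Diff_insert)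
      \<comment> \<open>The images of \<open>o1\<close> and \<open>nb j (x j)\<close> can differ
        only at \<open>\<pi> j\<close>, where \<open>\<sigma> x\<close> disagrees with the latter by
        assumption; so no difference in \<open>?T\<close> is lost.\<close>
      moreover have "?T \<subseteq> diff_coords k (\<sigma> x) (\<sigma> (nb j (x j)))"
        using neq unfolding \<sigma>_nb[OF j xj] by (auto simp: diff_coords_def)
      then have "card ?T \<le> hamming k (\<sigma> x) (\<sigma> (nb j (x j)))"
        unfolding hamming_def by (intro card_mono) auto
      ultimately show False
        using iso[OF x nb[OF j xj]] card_T by simp
    qed
    show ?thesis
    proof (cases "i \<in> ?S")
      case False
      have "\<pi> ` ?S \<subseteq> ?T"
      proof
        fix p assume "p \<in> \<pi> ` ?S"
        then obtain j where j: "j \<in> ?S" "p = \<pi> j" by auto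
        then have j1: "j \<in> {1..k}" "x j \<noteq> 1" using o1_i by (auto simp: diff_coords_def)
        then have "f j (x j) \<noteq> f j 1"
          using f_inj[OF j1(1) level_combs_level[OF x j1(1)], of 1] s by auto
        then show "p \<in> ?T"
          using on_S[OF j(1)] f_1[OF j1(1)] \<pi>_closed[OF j1(1)] j by (simp add: diff_coords_def)
      qed
      moreover have "card (\<pi> ` ?S) = card ?S"
        using \<pi>_inj by (intro card_image inj_onI) (auto simp: diff_coords_def)
      ultimately have "\<pi> ` ?S = ?T"
        using card_T by (intro card_subset_eq) auto
      moreover have "\<pi> i \<notin> \<pi> ` ?S"
        using False \<pi>_inj[OF i] by (auto simp: diff_coords_def)
      ultimately have "\<sigma> x (\<pi> i) = \<sigma> o1 (\<pi> i)"
        using \<pi>_closed[OF i] by (auto simp: diff_coords_def)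
      moreover have "x i = 1"
        using False i o1_i[OF i] by (simp add: diff_coords_def)
      ultimately show ?thesis using f_1[OF i] by simp
    qed (rule on_S)
  qed

  \<comment> \<open>The chosen \<open>\<pi>\<close> and \<open>f\<close> are arbitrary outside the
    relevant ranges and are replaced by the identity there. Reindexing by \<open>inv' \<rho>\<close>
    passes from source coordinates, used by \<open>f\<close>, to the target coordinates used by
    \<open>wreath_act\<close>.\<close>
  define \<rho> where "\<rho> = restrict_id \<pi> {1..k}"
  define g where "g j = restrict_id (f (inv' \<rho> j)) {1..s}" for j
  have \<rho>: "\<rho> permutes {1..k}"
    unfolding \<rho>_def
    by (rule restrict_id_permutes[OF finite_atLeastAtMost image_subsetI[OF \<pi>_closed]
          inj_onI[OF \<pi>_inj]])
  have \<rho>_inv: "inv' \<rho> j \<in> {1..k} \<and> \<pi> (inv' \<rho> j) = j" if "j \<in> {1..k}" for j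
  proof -
    have "inv' \<rho> j \<in> {1..k}"
      using that permutes_in_image[OF permutes_inv[OF \<rho>]] by blast
    then show ?thesis
      using permutes_inverses(1)[OF \<rho>, of j] unfolding \<rho>_def by simp
  qed
  have g: "g j permutes {1..s}" if "j \<in> {1..k}" for j
  proof -
    from \<rho>_inv[OF that] have "inv' \<rho> j \<in> {1..k}" ..
    then show ?thesis
      unfolding g_def
      by (intro restrict_id_permutes[OF finite_atLeastAtMost image_subsetI[OF f_closed]
            inj_onI[OF f_inj]])
  qed
  interpret wreath_elem s k g \<rho>
    using g \<rho> by (rule wreath_elem.intro)
  have "\<sigma> x = wreath_act s k g \<rho> x" for x
  proof (cases "x \<in> ?X")
    case True
    show ?thesis
    proof (rule level_combs_eqI[OF closed[OF True] wreath_act_closed[OF True]])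
      fix j assume j: "j \<in> {1..k}"
      then show "\<sigma> x j = wreath_act s k g \<rho> x j"
        using key[OF True, of "inv' \<rho> j"] \<rho>_inv[OF j] level_combs_level[OF True, of "inv' \<rho> j"]
        by (simp add: wreath_act_apply[OF True j] g_def del: atLeastAtMost_iff)
    qed
  next
    case False
    then show ?thesis
      using permutes_not_in[OF \<sigma>] permutes_not_in[OF wreath_act_permutes] by simp
  qed
  then have "\<sigma> = wreath_act s k g \<rho>" by auto
  then show ?thesis
    unfolding wreath_perms_def using wreath_elem_axioms by blast
qed


section \<open>Symmetries of the system as permutations of flats\<close>

definition flat :: "nat \<Rightarrow> nat \<Rightarrow> nat set \<Rightarrow> (nat \<Rightarrow> nat) \<Rightarrow> (nat \<Rightarrow> nat) set"
  where "flat s k I a = {x \<in> level_combs s k. \<forall>i\<in>I. x i = a i}"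

definition flats :: "nat \<Rightarrow> nat \<Rightarrow> nat \<Rightarrow> (nat \<Rightarrow> nat) set set"
  where "flats s k t = {flat s k I a | I a. I \<subseteq> {1..k} \<and> card I = t \<and> a \<in> level_combs s k}"

lemma flats_subset_Pow: "flats s k t \<subseteq> Pow (level_combs s k)"
  by (auto simp: flats_def flat_def)

lemma finite_flats: "finite (flats s k t)"
  using flats_subset_Pow finite_level_combs by (meson finite_Pow_iff finite_subset)

lemma oa_symmetries_iff_flats:
  assumes \<sigma>: "\<sigma> permutes level_combs s k"
  shows "\<sigma> \<in> oa_symmetries s k t l \<longleftrightarrow> (`) \<sigma> ` flats s k t = flats s k t"
proof -
  define E :: "(nat \<Rightarrow> nat) set \<Rightarrow> (nat \<Rightarrow> nat) lin_eq"
    where "E B = (\<lambda>x. of_bool (x \<in> B), int l)" for B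
  have oa_eq: "oa_eq s k l I a = E (flat s k I a)" for I a
    by (simp add: oa_eq_def flat_def E_def)
  have sys: "oa_system s k t l = E ` flats s k t"
    unfolding oa_system_def flats_def oa_eq
    by (rule Set.set_eqI) (simp only: image_iff mem_Collect_eq Bex_def, blast)
  have "inv' \<sigma> x \<in> B \<longleftrightarrow> x \<in> \<sigma> ` B" for x B
    using inj_image_mem_iff[OF permutes_inj[OF \<sigma>], of "inv' \<sigma> x" B]
    by (simp only: permutes_inverses(1)[OF \<sigma>])
  then have "permute_lin_eq \<sigma> (E B) = E (\<sigma> ` B)" for B
    by (simp add: permute_lin_eq_def E_def o_def)
  then have "permute_lin_eq \<sigma> ` oa_system s k t l = E ` (`) \<sigma> ` flats s k t"
    by (simp add: sys image_image)
  moreover have "inj E"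
    by (rule injI) (auto simp: E_def fun_eq_iff of_bool_eq_iff)
  ultimately show ?thesis
    using \<sigma> by (simp add: oa_symmetries_def sys inj_image_eq_iff)
qed

lemma oa_symmetries_permutes: "\<sigma> \<in> oa_symmetries s k t l \<Longrightarrow> \<sigma> permutes level_combs s k"
  by (simp add: oa_symmetries_def)

text \<open>The condition at \<open>i\<close> moves to \<open>\<pi> i\<close>, where the injective
  \<open>f (\<pi> i)\<close> is applied to both \<open>x i\<close> and \<open>a i\<close>.\<close>

lemma (in wreath_elem) wreath_act_image_flat:
  assumes I: "I \<subseteq> {1..k}" and a: "a \<in> level_combs s k"
  shows "wreath_act s k f \<pi> ` flat s k I a = flat s k (\<pi> ` I) (wreath_act s k f \<pi> a)"
proof -
  let ?p = "wreath_act s k f \<pi>"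
  have iff: "?p x (\<pi> i) = ?p a (\<pi> i) \<longleftrightarrow> x i = a i" if "x \<in> level_combs s k" "i \<in> I" for x i
  proof -
    have "\<pi> i \<in> {1..k}" using that I permutes_in_image[OF coords] by blast
    then show ?thesis
      using that a permutes_inj[OF levels]
      by (simp add: wreath_act_apply permutes_inverses(2)[OF coords] inj_eq del: atLeastAtMost_iff)
  qed
  show ?thesis
  proof (rule antisym)
    show "?p ` flat s k I a \<subseteq> flat s k (\<pi> ` I) (?p a)"
      using iff wreath_act_closed by (auto simp: flat_def)
    show "flat s k (\<pi> ` I) (?p a) \<subseteq> ?p ` flat s k I a"
    proof
      fix y assume y: "y \<in> flat s k (\<pi> ` I) (?p a)"
      then obtain x where x: "x \<in> level_combs s k" "y = ?p x"
        using permutes_image[OF wreath_act_permutes] by (auto simp: flat_def)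
      with y iff show "y \<in> ?p ` flat s k I a"
        by (auto simp: flat_def)
    qed
  qed
qed

lemma wreath_perms_subset_oa_symmetries: "wreath_perms s k \<subseteq> oa_symmetries s k t l"
proof
  fix p assume "p \<in> wreath_perms s k"
  then obtain f \<pi> where p: "p = wreath_act s k f \<pi>" and w: "wreath_elem s k f \<pi>"
    by (auto simp: wreath_perms_def)
  interpret wreath_elem s k f \<pi> by fact
  have perm: "p permutes level_combs s k" unfolding p by (rule wreath_act_permutes)
  have "(`) p ` flats s k t \<subseteq> flats s k t"
  proof
    fix C assume "C \<in> (`) p ` flats s k t"
    then obtain I a where C: "C = p ` flat s k I a"
      and I: "I \<subseteq> {1..k}" "card I = t" and a: "a \<in> level_combs s k"
      by (auto simp: flats_def)
    have "C = flat s k (\<pi> ` I) (p a)"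
      unfolding C p by (rule wreath_act_image_flat[OF I(1) a])
    moreover have "\<pi> ` I \<subseteq> {1..k}"
      using I(1) permutes_image[OF coords] by blast
    moreover have "card (\<pi> ` I) = t"
      using I(2) permutes_inj_on[OF coords] by (simp add: card_image)
    moreover have "p a \<in> level_combs s k"
      unfolding p by (rule wreath_act_closed[OF a])
    ultimately show "C \<in> flats s k t"
      unfolding flats_def by blast
  qed
  \<comment> \<open>An injective self-map of the finite set of flats is onto, which upgrades the
    inclusion to the required equality.\<close>
  moreover have "inj_on ((`) p) (flats s k t)"
    using permutes_inj[OF perm] by (intro inj_onI) (simp add: inj_image_eq_iff)
  ultimately show "p \<in> oa_symmetries s k t l"
    using endo_inj_surj[OF finite_flats] by (simp add: oa_symmetries_iff_flats[OF perm])
qed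

section \<open>Counting the flats through two points\<close>

text \<open>With two levels available, \<open>x\<close> can be altered at any coordinate outside
  \<open>J\<close> without leaving its \<open>J\<close>-flat, while altering it at a coordinate of
  \<open>I\<close> leaves the \<open>I\<close>-flat.\<close>

lemma flat_eqD:
  assumes "s \<ge> 2" and x: "x \<in> level_combs s k" and "I \<subseteq> {1..k}" and "flat s k I x = flat s k J x"
  shows "I \<subseteq> J"
proof
  fix i assume i: "i \<in> I"
  then have ik: "i \<in> {1..k}" using assms(3) by blast
  obtain a where a: "a \<in> {1..s}" "a \<noteq> x i"
  proof (cases "x i = 1")
    case True
    with \<open>s \<ge> 2\<close> show ?thesis by (intro that[of 2]) auto
  next
    case False
    with \<open>s \<ge> 2\<close> show ?thesis by (intro that[of 1]) auto
  qed
  show "i \<in> J"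
  proof (rule ccontr)
    assume "i \<notin> J"
    then have "x(i := a) \<in> flat s k J x"
      using level_combs_upd[OF x ik a(1)] by (auto simp: flat_def)
    then have "x(i := a) \<in> flat s k I x" using assms(4) by simp
    with i a(2) show False by (auto simp: flat_def)
  qed
qed

text \<open>A flat through \<open>x\<close> may be written with \<open>x\<close> as its base point;
  it contains \<open>y\<close> exactly when its index set avoids the coordinates where
  \<open>x\<close> and \<open>y\<close> differ.\<close>

lemma card_flats_through:
  assumes "s \<ge> 2" and x: "x \<in> level_combs s k" and y: "y \<in> level_combs s k"
  shows "card {B \<in> flats s k t. x \<in> B \<and> y \<in> B} = (k - hamming k x y) choose t"
proof -
  let ?A = "{1..k} - diff_coords k x y"
  have "{B \<in> flats s k t. x \<in> B \<and> y \<in> B} = (\<lambda>I. flat s k I x) ` {I. I \<subseteq> ?A \<and> card I = t}"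
  proof (rule antisym)
    show "{B \<in> flats s k t. x \<in> B \<and> y \<in> B} \<subseteq> (\<lambda>I. flat s k I x) ` {I. I \<subseteq> ?A \<and> card I = t}"
    proof
      fix B assume "B \<in> {B \<in> flats s k t. x \<in> B \<and> y \<in> B}"
      then obtain I a where I: "B = flat s k I a" "I \<subseteq> {1..k}" "card I = t"
        and xy: "x \<in> flat s k I a" "y \<in> flat s k I a"
        by (auto simp: flats_def)
      from xy(1) have "B = flat s k I x" unfolding I(1) by (auto simp: flat_def)
      moreover from xy I(2) have "I \<subseteq> ?A" by (auto simp: flat_def diff_coords_def)
      ultimately show "B \<in> (\<lambda>I. flat s k I x) ` {I. I \<subseteq> ?A \<and> card I = t}"
        using I(3) by blast
    qed
    show "(\<lambda>I. flat s k I x) ` {I. I \<subseteq> ?A \<and> card I = t} \<subseteq> {B \<in> flats s k t. x \<in> B \<and> y \<in> B}"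
    proof (rule image_subsetI)
      fix I assume "I \<in> {I. I \<subseteq> ?A \<and> card I = t}"
      then have I: "I \<subseteq> {1..k}" "card I = t" "\<forall>i\<in>I. y i = x i"
        by (auto simp: diff_coords_def)
      with x have "flat s k I x \<in> flats s k t" unfolding flats_def by blast
      with I x y show "flat s k I x \<in> {B \<in> flats s k t. x \<in> B \<and> y \<in> B}"
        by (simp add: flat_def)
    qed
  qed
  moreover have "inj_on (\<lambda>I. flat s k I x) {I. I \<subseteq> ?A \<and> card I = t}"
  proof (rule inj_onI)
    fix I J assume "I \<in> {I. I \<subseteq> ?A \<and> card I = t}" "J \<in> {I. I \<subseteq> ?A \<and> card I = t}"
      and eq: "flat s k I x = flat s k J x"
    then have "I \<subseteq> {1..k}" "J \<subseteq> {1..k}" by auto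
    then show "I = J"
      using flat_eqD[OF assms(1) x _ eq] flat_eqD[OF assms(1) x _ eq[symmetric]] by blast
  qed
  ultimately have "card {B \<in> flats s k t. x \<in> B \<and> y \<in> B} = card {I. I \<subseteq> ?A \<and> card I = t}"
    by (simp add: card_image)
  also have "\<dots> = card ?A choose t" by (rule n_subsets) simp
  also have "card ?A = k - hamming k x y"
    by (subst card_Diff_subset) (auto simp: hamming_def diff_coords_def)
  finally show ?thesis .
qed

text \<open>By Pascal's rule \<open>n choose t\<close> exceeds \<open>(n - 1) choose t\<close> by
  \<open>(n - 1) choose (t - 1)\<close>, which is positive.\<close>

lemma choose_less_choose:
  assumes "0 < t" "t \<le> n" "m < n"
  shows "m choose t < n choose t"
proof -
  obtain n' t' where n: "n = Suc n'" and t: "t = Suc t'"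
    using assms by (metis gr0_conv_Suc less_imp_Suc_add)
  have "m choose t \<le> n' choose t"
    using assms n by (intro binomial_right_mono) simp
  moreover have "0 < n' choose t'"
    using assms n t by simp
  ultimately show ?thesis
    unfolding n t binomial_Suc_Suc by linarith
qed

text \<open>For \<open>d \<ge> 2\<close> the upper index drops below \<open>k - 1\<close>, also when
  \<open>k - d\<close> is truncated to 0, and \<open>0 < t \<le> k - 1\<close> makes the drop
  strict. At \<open>t = 0\<close> all these numbers are 1, and at \<open>t = k\<close> they vanish
  for every \<open>d \<ge> 1\<close>, so adjacency would be invisible.\<close>

lemma choose_hamming_eq_iff:
  assumes "0 < t" "t < k"
  shows "(k - d) choose t = (k - 1) choose t \<and> d \<noteq> 0 \<longleftrightarrow> d = 1"
proof (cases "d \<le> 1")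
  case False
  then have "(k - d) choose t < (k - 1) choose t"
    using assms by (intro choose_less_choose) linarith+
  with False show ?thesis by simp
qed auto

lemma oa_symmetries_subset_wreath_perms:
  assumes "s \<ge> 2" "0 < t" "t < k"
  shows "oa_symmetries s k t l \<subseteq> wreath_perms s k"
proof
  fix \<sigma> assume sym: "\<sigma> \<in> oa_symmetries s k t l"
  then have \<sigma>: "\<sigma> permutes level_combs s k" by (rule oa_symmetries_permutes)
  with sym have flats: "(`) \<sigma> ` flats s k t = flats s k t"
    by (simp add: oa_symmetries_iff_flats)
  note inj = permutes_inj[OF \<sigma>]
  show "\<sigma> \<in> wreath_perms s k"
  proof (rule hamming_automorphism_wreath[OF assms(1) \<sigma>])
    fix x y assume x: "x \<in> level_combs s k" and y: "y \<in> level_combs s k"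
    then have \<sigma>x: "\<sigma> x \<in> level_combs s k" and \<sigma>y: "\<sigma> y \<in> level_combs s k"
      using permutes_in_image[OF \<sigma>] by auto
    \<comment> \<open>Since \<open>\<sigma>\<close> permutes the flats, those through the images of
      \<open>x\<close> and \<open>y\<close> are the images of those through \<open>x\<close> and
      \<open>y\<close>.\<close>
    have "{B \<in> flats s k t. \<sigma> x \<in> B \<and> \<sigma> y \<in> B} =
        {B \<in> (`) \<sigma> ` flats s k t. \<sigma> x \<in> B \<and> \<sigma> y \<in> B}"
      by (simp only: flats)
    also have "\<dots> = (`) \<sigma> ` {B \<in> flats s k t. \<sigma> x \<in> \<sigma> ` B \<and> \<sigma> y \<in> \<sigma> ` B}"
      by blast
    also have "\<dots> = (`) \<sigma> ` {B \<in> flats s k t. x \<in> B \<and> y \<in> B}"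
      by (simp only: inj_image_mem_iff[OF inj])
    finally have "card {B \<in> flats s k t. \<sigma> x \<in> B \<and> \<sigma> y \<in> B} =
        card {B \<in> flats s k t. x \<in> B \<and> y \<in> B}"
      by (simp add: card_image inj_on_def inj_image_eq_iff[OF inj])
    then have "(k - hamming k (\<sigma> x) (\<sigma> y)) choose t = (k - hamming k x y) choose t"
      unfolding card_flats_through[OF assms(1) x y] card_flats_through[OF assms(1) \<sigma>x \<sigma>y] .
    moreover have "hamming k (\<sigma> x) (\<sigma> y) = 0 \<longleftrightarrow> hamming k x y = 0"
      unfolding hamming_eq_0[OF x y] hamming_eq_0[OF \<sigma>x \<sigma>y] using inj by (simp add: inj_eq)
    ultimately show "hamming k (\<sigma> x) (\<sigma> y) = 1 \<longleftrightarrow> hamming k x y = 1"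
      using choose_hamming_eq_iff[OF assms(2,3)] by metis
  qed
qed

section \<open>The extreme cases \<open>t = 0\<close> and \<open>t = k\<close>\<close>

lemma flats_0:
  assumes "s \<ge> 1"
  shows "flats s k 0 = {level_combs s k}"
proof -
  have "flat s k I a = level_combs s k" if "I \<subseteq> {1..k}" "card I = 0" for I a
    using that finite_subset[OF that(1)] by (auto simp: flat_def)
  \<comment> \<open>Some base point must exist for there to be a flat at all.\<close>
  moreover have "(\<lambda>i\<in>{1..k}. 1) \<in> level_combs s k" using assms by (simp add: level_combs_def)
  ultimately show ?thesis
    unfolding flats_def by (auto intro!: exI[of _ "{}"])
qed

lemma flats_full: "flats s k k = (\<lambda>x. {x}) ` level_combs s k"
proof -
  have "I \<subseteq> {1..k} \<and> card I = k \<and> P \<longleftrightarrow> I = {1..k} \<and> P" for I P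
    using card_subset_eq[of "{1..k}" I] by auto
  then have "flats s k k = {flat s k I a | I a. I = {1..k} \<and> a \<in> level_combs s k}"
    unfolding flats_def by (simp only:)
  also have "\<dots> = flat s k {1..k} ` level_combs s k"
    by (rule Set.set_eqI) (simp only: image_iff mem_Collect_eq Bex_def, blast)
  also have "flat s k {1..k} a = {a}" if "a \<in> level_combs s k" for a
    using that level_combs_eqI[OF _ that] by (auto simp: flat_def)
  then have "flat s k {1..k} ` level_combs s k = (\<lambda>x. {x}) ` level_combs s k"
    by (intro image_cong) auto
  finally show ?thesis .
qed

theorem theorem13:
  fixes s k t l :: nat
  assumes "s \<ge> 2" and "k \<ge> 1" and "t \<le> k" and "l \<ge> 1"
  shows "(t \<noteq> 0 \<and> t \<noteq> k \<longrightarrow> oa_symmetries s k t l = coord_level_group s k)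
       \<and> (perm_group (level_combs s k)) \<lparr> carrier := coord_level_group s k \<rparr>
           \<cong> wreath_sym (sym_group s) k
       \<and> (t = 0 \<or> t = k \<longrightarrow>
           oa_symmetries s k t l = carrier (perm_group (level_combs s k)))"
proof (intro conjI impI)
  assume "t \<noteq> 0 \<and> t \<noteq> k"
  then show "oa_symmetries s k t l = coord_level_group s k"
    using assms oa_symmetries_subset_wreath_perms wreath_perms_subset_oa_symmetries
    by (simp add: coord_level_group_eq subset_antisym)
next
  show "(perm_group (level_combs s k)) \<lparr> carrier := coord_level_group s k \<rparr>
      \<cong> wreath_sym (sym_group s) k"
    unfolding coord_level_group_eq
    \<comment> \<open>The action maps the abstract wreath product to the permutation group, so its
      inverse gives the stated direction.\<close>
    by (rule is_isoI[OF iso_inv_into[OF wreath_act_iso[OF assms(1)] wreath_sym_mult_closed]])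
next
  assume "t = 0 \<or> t = k"
  \<comment> \<open>The flats are the whole space alone or all singletons, and any permutation
    preserves either family.\<close>
  then have "(`) \<sigma> ` flats s k t = flats s k t" if "\<sigma> permutes level_combs s k" for \<sigma>
  proof
    have "(`) \<sigma> ` (\<lambda>x. {x}) ` level_combs s k = (\<lambda>x. {x}) ` \<sigma> ` level_combs s k"
      by (simp add: image_image)
    then show "(`) \<sigma> ` flats s k t = flats s k t" if "t = k"
      by (simp add: that flats_full permutes_image[OF \<open>\<sigma> permutes level_combs s k\<close>])
  qed (use assms permutes_image[OF that] in \<open>simp add: flats_0\<close>)
  then show "oa_symmetries s k t l = carrier (perm_group (level_combs s k))"
    by (auto simp only: oa_symmetries_iff_flats perm_group_def partial_object.simps mem_Collect_eq
        dest: oa_symmetries_permutes)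
qed

end
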